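(* Let $D\in\mathbb{R}^{n\times k}$, let $m\ge1$ be an integer, $s>1$, $g(P)=[\mathrm{tr}((P^{\mathrm T}D)^m)]^s$, and $\mathbb{P}=\mathrm{St}(k,n)_{D+}$. Let $$H(P)=m\Big[D(P^{\mathrm T}D)^{m-1}P^{\mathrm T}+P(D^{\mathrm T}P)^{m-1}D^{\mathrm T}\Big],\qquad H_g(P)=s\,[\mathrm{tr}((P^{\mathrm T}D)^m)]^{s-1}H(P),$$ for which $H_g(P)P-\frac{\partial g(P)}{\partial P}=P\big[sm\,[\mathrm{tr}((P^{\mathrm T}D)^m)]^{s-1}(D^{\mathrm T}P)^m\big]$. Then $$\mathrm{tr}(P^{\mathrm T}H_g(P)P)=2sm\,[\mathrm{tr}((P^{\mathrm T}D)^m)]^s\quad\text{for }P\in\mathbb{P},$$ $$\mathrm{tr}(\widetilde P^{\mathrm T}H_g(P)\widetilde P)\le2[\mathrm{tr}((\widetilde P^{\mathrm T}D)^m)]^s+2(sm-1)[\mathrm{tr}((P^{\mathrm T}D)^m)]^s\quad\text{for }P,\widetilde P\in\mathbb{P}.$$ These imply that conditions (1) and (2) of the definition of an atomic function for NEPv hold for $g$ with $H_g$, $\underline{\alpha}=2$ and $\underline{\beta}=2(sm-1)$, and thus $g(P)=[\mathrm{tr}((P^{\mathrm T}D)^m)]^s$ for $s>1$ is an atomic function for NEPv.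
   Context: $1\le k\le n$; $\mathrm{St}(k,n)=\{P\in\mathbb{R}^{n\times k}: P^{\mathrm T}P=I_k\}$; $\mathrm{St}(k,n)_{D+}=\{X\in\mathrm{St}(k,n): X^{\mathrm T}D\succeq0\}$; $A\succeq0$ means symmetric positive semidefinite. $g$ is well defined at $P$ whenever $\mathrm{tr}((P^{\mathrm T}D)^m)\ge0$, in particular for $P\in\mathbb{P}$; the functions $g$ and $H_g$ are considered at such points, and $\frac{\partial g(P)}{\partial P}=s[\mathrm{tr}((P^{\mathrm T}D)^m)]^{s-1}\frac{\partial\,\mathrm{tr}((P^{\mathrm T}D)^m)}{\partial P}$ is the Euclidean gradient (matrix of partial derivatives; read as $0$ where the trace vanishes). Atomic function for NEPv: a function $f$ (on a neighborhood of $\mathrm{St}(k,n)$; here, where well defined) for which there are a symmetric matrix-valued function $H_f(P)\in\mathbb{R}^{n\times n}$, a subset $\mathbb{P}\subseteq\mathrm{St}(k,n)$ and constants $\underline{\alpha}>0$, $\underline{\beta}\ge 0$, $\underline{\gamma}=\underline{\alpha}+\underline{\beta}$ such that (1) $\mathrm{tr}(P^{\mathrm T}H_f(P)P)=\underline{\gamma} f(P)$ for all $P\in\mathbb{P}$; and (2) given $P\in\mathbb{P}$ and $\widehat P\in\mathrm{St}(k,n)$, there exists $Q\in\mathrm{St}(k,k)$ such that $\widetilde P=\widehat PQ\in\mathbb{P}$ and $\mathrm{tr}(\widehat P^{\mathrm T}H_f(P)\widehat P)\le\underline{\alpha} f(\widetilde P)+\underline{\beta} f(P)$. *)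

theory Defs
  imports "HOL-Analysis.Analysis"
begin

text \<open>An element of \<open>real^'k^'n\<close> is a matrix with \<open>n = CARD('n)\<close> rows and \<open>k = CARD('k)\<close> columns.\<close>

(* On vectors of vectors the library's power ^ is componentwise; this is the matrix product power. *)
primrec matpow :: "real^'a^'a \<Rightarrow> nat \<Rightarrow> real^'a^'a" where
  "matpow A 0 = mat 1"
| "matpow A (Suc m) = A ** matpow A m"

definition psd :: "real^'a^'a \<Rightarrow> bool" where
  "psd A \<longleftrightarrow> transpose A = A \<and> (\<forall>x. 0 \<le> x \<bullet> (A *v x))"

definition stiefel :: "(real^'k^'n) set" where
  "stiefel = {P. transpose P ** P = mat 1}"

definition stiefel_plus :: "real^'k^'n \<Rightarrow> (real^'k^'n) set" where
  "stiefel_plus D = {X \<in> stiefel. psd (transpose X ** D)}"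

text \<open>The matrix of partial derivatives; \<open>axis i (axis j 1)\<close> is the matrix unit
  with entry 1 in row \<open>i\<close> and column \<open>j\<close>.\<close>
definition matrix_gradient :: "(real^'k^'n \<Rightarrow> real) \<Rightarrow> real^'k^'n \<Rightarrow> real^'k^'n" where
  "matrix_gradient f P = (\<chi> i j. deriv (\<lambda>t. f (P + t *\<^sub>R axis i (axis j 1))) 0)"

text \<open>Atomic functions for NEPv. Functions in HOL are total, so the set \<open>U\<close> records the points
  at which \<open>f\<close> and \<open>H\<close> are regarded as defined; their values elsewhere play no role.\<close>
definition atomic_NEPv_with ::
  "(real^'k^'n) set \<Rightarrow> (real^'k^'n \<Rightarrow> real) \<Rightarrow> (real^'k^'n \<Rightarrow> real^'n^'n) \<Rightarrow>
   (real^'k^'n) set \<Rightarrow> real \<Rightarrow> real \<Rightarrow> bool" where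
  "atomic_NEPv_with U f H PP \<alpha> \<beta> \<longleftrightarrow>
     \<alpha> > 0 \<and> \<beta> \<ge> 0 \<and> PP \<subseteq> stiefel \<inter> U \<and>
     (\<forall>P\<in>U. transpose (H P) = H P) \<and>
     (\<forall>P\<in>PP. trace (transpose P ** H P ** P) = (\<alpha> + \<beta>) * f P) \<and>
     (\<forall>P\<in>PP. \<forall>Ph\<in>stiefel. \<exists>Q::real^'k^'k. Q \<in> stiefel \<and> Ph ** Q \<in> PP \<and>
        trace (transpose Ph ** H P ** Ph) \<le> \<alpha> * f (Ph ** Q) + \<beta> * f P)"

definition atomic_NEPv :: "(real^'k^'n) set \<Rightarrow> (real^'k^'n \<Rightarrow> real) \<Rightarrow> bool" where
  "atomic_NEPv U f \<longleftrightarrow> (\<exists>H PP \<alpha> \<beta>. atomic_NEPv_with U f H PP \<alpha> \<beta>)"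

definition trpow :: "real^'k^'n \<Rightarrow> nat \<Rightarrow> real^'k^'n \<Rightarrow> real" where
  "trpow D m P = trace (matpow (transpose P ** D) m)"

definition gfun :: "real^'k^'n \<Rightarrow> nat \<Rightarrow> real \<Rightarrow> real^'k^'n \<Rightarrow> real" where
  "gfun D m s P = trpow D m P powr s"

definition gdom :: "real^'k^'n \<Rightarrow> nat \<Rightarrow> (real^'k^'n) set" where
  "gdom D m = {P. trpow D m P \<ge> 0}"

text \<open>Points with vanishing trace may lie on the boundary of the domain of \<open>g\<close>;
  by convention the gradient is read as \<open>0\<close> there.\<close>
definition grad_g :: "real^'k^'n \<Rightarrow> nat \<Rightarrow> real \<Rightarrow> real^'k^'n \<Rightarrow> real^'k^'n" where
  "grad_g D m s P = (if trpow D m P = 0 then 0 else matrix_gradient (gfun D m s) P)"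

definition Hmat :: "real^'k^'n \<Rightarrow> nat \<Rightarrow> real^'k^'n \<Rightarrow> real^'n^'n" where
  "Hmat D m P = real m *\<^sub>R
     (D ** matpow (transpose P ** D) (m - 1) ** transpose P +
      P ** matpow (transpose D ** P) (m - 1) ** transpose D)"

definition Hg :: "real^'k^'n \<Rightarrow> nat \<Rightarrow> real \<Rightarrow> real^'k^'n \<Rightarrow> real^'n^'n" where
  "Hg D m s P = (s * trpow D m P powr (s - 1)) *\<^sub>R Hmat D m P"

end

theory Submission
  imports Defs
begin

text \<open>Write \<open>R\<close> for the second point. The trace on the left of the inequality is \<open>2 s m t\<^sup>s\<^sup>-\<^sup>1 tr (B A\<^sup>m\<^sup>-\<^sup>1 W)\<close>, where
  \<open>A = P\<^sup>T D\<close> and \<open>B = R\<^sup>T D\<close> are positive semidefinite, \<open>t = tr (A\<^sup>m)\<close>, and \<open>W = P\<^sup>T R\<close> is a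
  contraction. Two instances of Young's inequality bound it: a spectral one,
  \<open>m tr (B A\<^sup>m\<^sup>-\<^sup>1 W) \<le> tr (B\<^sup>m) + (m - 1) tr (A\<^sup>m)\<close>, and then the scalar one for the exponent \<open>s\<close>.
  The rotation \<open>Q\<close> of condition (2) comes from a polar decomposition. Both the polar decomposition and
  the spectral theorem are read off a maximizer of a suitable function on the compact
  orthogonal group, tested against plane rotations.\<close>

section \<open>The orthogonal group: row criterion, compactness, plane rotations\<close>

lemma matrix_mult_component_inner:
  fixes A :: "real^'k^'n" and M :: "real^'k^'m"
  shows "(A ** transpose M) $ i $ j = A $ i \<bullet> M $ j"
  by (simp add: matrix_matrix_mult_def transpose_def inner_vec_def)

lemma transpose_mult_self_eq_1:
  "A ** transpose A = mat 1 \<longleftrightarrow> (\<forall>i j. A $ i \<bullet> A $ j = (if i = j then 1 else 0))"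
  for A :: "real^'k^'n"
  by (simp add: vec_eq_iff matrix_mult_component_inner mat_def)

lemma stiefel_transpose_iff: "transpose U \<in> stiefel \<longleftrightarrow> U \<in> stiefel"
  for U :: "real^'k^'k"
  by (simp add: stiefel_def matrix_left_right_inverse)

lemma stiefel_rows:
  "U \<in> stiefel \<longleftrightarrow> (\<forall>i j. U $ i \<bullet> U $ j = (if i = j then 1 else 0))"
  for U :: "real^'k^'k"
  unfolding transpose_mult_self_eq_1[symmetric] by (simp add: stiefel_def matrix_left_right_inverse)

text \<open>Closed because finitely many polynomial equations in the rows cut it out; bounded
  because every row is a unit vector.\<close>

lemma compact_stiefel_square: "compact (stiefel :: (real^'k^'k) set)"
proof -
  have eq: "stiefel = (\<Inter>i. \<Inter>j. {U :: real^'k^'k. U $ i \<bullet> U $ j = (if i = j then 1 else 0)})"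
    by (auto simp: stiefel_rows)
  have "closed (stiefel :: (real^'k^'k) set)"
    unfolding eq by (intro closed_INT ballI closed_Collect_eq continuous_intros)
  moreover have "bounded (stiefel :: (real^'k^'k) set)"
    unfolding bounded_iff
  proof (intro exI ballI)
    fix U :: "real^'k^'k" assume "U \<in> stiefel"
    then have "norm (U $ i) = 1" for i
      by (simp add: stiefel_rows norm_eq_1)
    then show "norm U \<le> (\<Sum>i\<in>(UNIV::'k set). 1)"
      using L2_set_le_sum[of UNIV "\<lambda>i. norm (U $ i)"] by (simp only: norm_vec_def[of U])
  qed
  ultimately show ?thesis
    by (simp add: compact_eq_bounded_closed)
qed

lemma stiefel_square_nonempty: "(stiefel :: (real^'k^'k) set) \<noteq> {}"
  by (auto simp: stiefel_def intro!: exI[of _ "mat 1"])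

text \<open>When \<open>x\<^sup>2 + y\<^sup>2 = 1\<close>, this is left multiplication by a Givens
  rotation with cosine \<open>x\<close> and sine \<open>y\<close>.\<close>

definition rot_rows :: "'k \<Rightarrow> 'k \<Rightarrow> real \<Rightarrow> real \<Rightarrow> real^'k^'k \<Rightarrow> real^'k^'k" where
  "rot_rows i j x y U =
    (\<chi> a. if a = i then x *\<^sub>R U $ i + y *\<^sub>R U $ j
          else if a = j then x *\<^sub>R U $ j - y *\<^sub>R U $ i else U $ a)"

lemma rot_rows_stiefel:
  assumes "U \<in> stiefel" "i \<noteq> j" "x\<^sup>2 + y\<^sup>2 = 1"
  shows "rot_rows i j x y U \<in> stiefel"
  using assms
  by (auto simp: stiefel_rows rot_rows_def inner_simps power2_eq_square algebra_simps)

lemma sum_remove_two: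
  fixes F :: "'k::finite \<Rightarrow> real"
  assumes "i \<noteq> j"
  shows "sum F UNIV = F i + F j + sum F (UNIV - {i, j})"
proof -
  have "sum F UNIV = F i + sum F (UNIV - {i})"
    by (simp add: sum.remove)
  also have "sum F (UNIV - {i}) = F j + sum F (UNIV - {i} - {j})"
    using assms by (intro sum.remove) auto
  finally show ?thesis
    by (simp add: Diff_insert2[symmetric] insert_commute)
qed

text \<open>Reduces testing a maximizer to two rows. \<open>F\<close> depends on the row index so
  that it can carry the weights \<open>c a\<close> in one maximization and the targets
  \<open>N $ a\<close> in the other.\<close>

lemma sum_rot_rows:
  assumes "i \<noteq> j"
  shows "(\<Sum>a\<in>UNIV. F a (rot_rows i j x y U $ a)) - (\<Sum>a\<in>UNIV. F a (U $ a)) =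
    F i (x *\<^sub>R U $ i + y *\<^sub>R U $ j) + F j (x *\<^sub>R U $ j - y *\<^sub>R U $ i) - F i (U $ i) - (F j (U $ j) :: real)"
proof -
  have "(\<Sum>a\<in>UNIV - {i, j}. F a (rot_rows i j x y U $ a)) = (\<Sum>a\<in>UNIV - {i, j}. F a (U $ a))"
    by (intro sum.cong) (auto simp: rot_rows_def)
  then show ?thesis
    using assms by (simp add: sum_remove_two[OF assms] rot_rows_def)
qed

text \<open>Stands in for a vanishing derivative at a maximizer: near 0 a nonzero linear term
  outgrows any quadratic one.\<close>

lemma linear_le_quadratic_imp_0:
  fixes p q :: real
  assumes "\<And>t. q * t \<le> p * t\<^sup>2"
  shows "q = 0"
proof (rule ccontr)
  assume q: "q \<noteq> 0"
  \<comment> \<open>\<open>r\<close> is positive and exceeds \<open>p\<close>, so testing at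
    \<open>q / r\<close> contradicts \<open>q \<noteq> 0\<close>.\<close>
  define r where "r = 1 + \<bar>p\<bar>"
  have r: "r > 0" "p < r" by (auto simp: r_def)
  have "q * (q / r) \<le> p * (q / r)\<^sup>2" by (rule assms)
  then have "q\<^sup>2 * r \<le> p * q\<^sup>2"
    using r by (simp add: field_simps power2_eq_square)
  then show False
    using q r by (simp add: mult.commute[of p])
qed

section \<open>The spectral theorem for real symmetric matrices\<close>

definition diag :: "real^'k \<Rightarrow> real^'k^'k" where
  "diag d = (\<chi> i j. if i = j then d $ i else 0)"

theorem spectral_symmetric:
  fixes A :: "real^'k^'k"
  assumes sym: "transpose A = A"
  obtains U :: "real^'k^'k" and d where "U \<in> stiefel" "A = transpose U ** diag d ** U"
proof -
  have A_sym: "x \<bullet> (A *v y) = y \<bullet> (A *v x)" for x y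
    by (metis sym dot_lmul_matrix inner_commute vector_transpose_matrix)
  \<comment> \<open>Distinct weights: a rotation in the plane of rows \<open>i\<close>, \<open>j\<close> changes the weighted diagonal sum
    to first order by \<open>2 (c i - c j)\<close> times the off-diagonal entry, which therefore vanishes.\<close>
  obtain c :: "'k \<Rightarrow> nat" where c: "inj c"
    using finite_imp_inj_to_nat_seg[of "UNIV :: 'k set"] by auto
  let ?f = "\<lambda>U :: real^'k^'k. \<Sum>a\<in>UNIV. real (c a) * (U $ a \<bullet> (A *v U $ a))"
  have "continuous_on stiefel ?f"
    by (intro continuous_intros linear_continuous_on_compose[OF _ matrix_vector_mul_linear])
  then obtain U where U: "U \<in> stiefel" and max: "\<And>V. V \<in> stiefel \<Longrightarrow> ?f V \<le> ?f U"
    using continuous_attains_sup[OF compact_stiefel_square stiefel_square_nonempty] by blast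
  have off: "U $ i \<bullet> (A *v U $ j) = 0" if ij: "i \<noteq> j" for i j
  proof -
    define q where "q = 2 * (real (c i) - real (c j)) * (U $ i \<bullet> (A *v U $ j))"
    define p where "p = (real (c i) - real (c j)) * (U $ i \<bullet> (A *v U $ i) - U $ j \<bullet> (A *v U $ j))"
    have circle: "q * (x * y) \<le> p * y\<^sup>2" if xy: "x\<^sup>2 + y\<^sup>2 = 1" for x y :: real
    proof -
      have "?f (rot_rows i j x y U) - ?f U \<le> 0"
        using max[OF rot_rows_stiefel[OF U ij xy]] by simp
      \<comment> \<open>The last summand vanishes on the unit circle; including it makes this a
        polynomial identity in \<open>x\<close> and \<open>y\<close>.\<close>
      moreover have "?f (rot_rows i j x y U) - ?f U = q * (x * y) - p * y\<^sup>2
          + (x\<^sup>2 + y\<^sup>2 - 1) * (real (c i) * (U $ i \<bullet> (A *v U $ i)) + real (c j) * (U $ j \<bullet> (A *v U $ j)))"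
        unfolding sum_rot_rows[OF ij, where F = "\<lambda>a u. real (c a) * (u \<bullet> (A *v u))"]
        by (simp add: inner_simps matrix_vector_right_distrib matrix_vector_mult_diff_distrib
            matrix_vector_mult_scaleR A_sym[of "U $ j" "U $ i"] p_def q_def)
          (simp add: algebra_simps power2_eq_square)
      ultimately show ?thesis using xy by simp
    qed
    have "q * t \<le> p * t\<^sup>2" for t
    proof -
      \<comment> \<open>Dividing \<open>(1, t)\<close> by \<open>r\<close> puts it on the unit
        circle; \<open>circle\<close> is homogeneous of degree two, so the scale cancels.\<close>
      define r where "r = sqrt (1 + t\<^sup>2)"
      have "1 + t\<^sup>2 > 0" by (intro add_pos_nonneg) auto
      then have r: "r > 0" "r\<^sup>2 = 1 + t\<^sup>2" by (simp_all add: r_def)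
      then have "(1 / r)\<^sup>2 + (t / r)\<^sup>2 = 1"
        using \<open>1 + t\<^sup>2 > 0\<close> by (simp add: power_divide add_divide_distrib[symmetric])
      from circle[OF this] have "q * t / r\<^sup>2 \<le> p * t\<^sup>2 / r\<^sup>2"
        by (simp add: power2_eq_square)
      then show ?thesis using r by (simp add: divide_le_cancel \<open>1 + t\<^sup>2 > 0\<close> order.asym)
    qed
    then have "q = 0" by (rule linear_le_quadratic_imp_0)
    then show ?thesis
      using c ij by (auto simp: q_def dest: injD)
  qed
  define d where "d = (\<chi> i. U $ i \<bullet> (A *v U $ i))"
  have "U ** A ** transpose U = diag d"
  proof -
    have "(U ** A ** transpose U) $ i $ j = U $ i \<bullet> (A *v U $ j)" for i j
    proof -
      have "(U ** A) $ i = U $ i v* A"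
        by (simp add: vec_eq_iff matrix_matrix_mult_def vector_matrix_mult_def mult.commute)
      then show ?thesis
        by (simp add: matrix_mult_component_inner dot_lmul_matrix)
    qed
    then show ?thesis
      by (auto simp: vec_eq_iff diag_def d_def off)
  qed
  moreover have "transpose U ** U = mat 1" using U by (simp add: stiefel_def)
  ultimately have "A = transpose U ** diag d ** U"
    by (metis matrix_mul_assoc matrix_mul_lid matrix_mul_rid)
  with U that show thesis by blast
qed

section \<open>The polar decomposition\<close>

theorem polar_decomposition:
  fixes M :: "real^'k^'k"
  obtains Q where "Q \<in> stiefel" "psd (transpose Q ** M)"
proof -
  \<comment> \<open>The rows of \<open>N\<close> are the columns of \<open>M\<close>, so the
    objective \<open>trace (V ** M)\<close> becomes a sum over rows, as \<open>sum_rot_rows\<close>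
    requires.\<close>
  define N where "N = transpose M"
  let ?f = "\<lambda>U :: real^'k^'k. \<Sum>a\<in>UNIV. U $ a \<bullet> N $ a"
  have "continuous_on stiefel ?f"
    by (intro continuous_intros)
  then obtain U where U: "U \<in> stiefel" and max: "\<And>V. V \<in> stiefel \<Longrightarrow> ?f V \<le> ?f U"
    using continuous_attains_sup[OF compact_stiefel_square stiefel_square_nonempty] by blast
  have trf: "?f V = trace (V ** M)" for V
    by (simp add: trace_def N_def flip: matrix_mult_component_inner)
  have sym: "U $ i \<bullet> N $ j = U $ j \<bullet> N $ i" if ij: "i \<noteq> j" for i j
  proof -
    define q where "q = U $ j \<bullet> N $ i - U $ i \<bullet> N $ j"
    define p where "p = U $ i \<bullet> N $ i + U $ j \<bullet> N $ j"
    have "q * t \<le> p * t\<^sup>2" for t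
    proof -
      \<comment> \<open>This objective is linear in the rotation. In the rational parametrization of
        the circle, \<open>x - 1\<close> carries \<open>t\<^sup>2\<close> and \<open>y\<close>
        carries \<open>t\<close> over the same denominator, so maximality compares a linear term
        with a quadratic one.\<close>
      define r where "r = 1 + t\<^sup>2"
      have r: "r > 0" unfolding r_def by (intro add_pos_nonneg) auto
      define x where "x = (1 - t\<^sup>2) / r"
      define y where "y = 2 * t / r"
      have "(1 - t\<^sup>2)\<^sup>2 + (2 * t)\<^sup>2 = r\<^sup>2"
        by (simp add: r_def power2_eq_square algebra_simps)
      then have xy: "x\<^sup>2 + y\<^sup>2 = 1"
        using r by (simp add: x_def y_def power_divide add_divide_distrib[symmetric])
      have "?f (rot_rows i j x y U) - ?f U \<le> 0"
        using max[OF rot_rows_stiefel[OF U ij xy]] by simp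
      moreover have "?f (rot_rows i j x y U) - ?f U = (x - 1) * p + y * q"
        unfolding sum_rot_rows[OF ij, where F = "\<lambda>a u. u \<bullet> N $ a"]
        by (simp add: inner_simps p_def q_def algebra_simps)
      moreover have "x - 1 = - 2 * t\<^sup>2 / r"
        using r by (simp add: x_def r_def field_simps)
      ultimately have "(2 * t * q - 2 * t\<^sup>2 * p) / r \<le> 0"
        by (simp add: y_def diff_divide_distrib)
      then show ?thesis
        using r by (simp add: divide_le_0_iff algebra_simps)
    qed
    then have "q = 0" by (rule linear_le_quadratic_imp_0)
    then show ?thesis by (simp add: q_def)
  qed
  have "transpose (U ** M) = U ** M"
  proof -
    have "(U ** M) $ i $ j = U $ i \<bullet> N $ j" for i j
      by (simp add: N_def flip: matrix_mult_component_inner)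
    then show ?thesis
      using sym by (simp add: vec_eq_iff transpose_def) metis
  qed
  \<comment> \<open>The rotation tests gave symmetry. Nonnegativity comes from the Householder
    reflection \<open>R\<close> along the normalized vector \<open>w\<close>: it lowers the trace by
    \<open>2 * (w \<bullet> (U ** M *v w))\<close>, and at a maximizer the trace cannot
    rise.\<close>
  moreover have "0 \<le> v \<bullet> (U ** M *v v)" for v
  proof (cases "v = 0")
    case False
    define w where "w = v /\<^sub>R norm v"
    have w: "w \<bullet> w = 1" using False by (simp add: w_def flip: norm_eq_1 del: inner_scaleR_left inner_scaleR_right)
    define R :: "real^'k^'k" where "R = (\<chi> i j. (if i = j then 1 else 0) - 2 * w $ i * w $ j)"
    have Rrow: "R $ i = axis i 1 - (2 * w $ i) *\<^sub>R w" for i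
      by (auto simp: R_def vec_eq_iff axis_def)
    have "R $ i \<bullet> R $ j = (if i = j then 1 else 0)" for i j
      by (simp add: Rrow inner_simps inner_axis inner_axis' w) (simp add: axis_def)
    then have "R \<in> stiefel" by (simp add: stiefel_rows)
    then have "R ** U \<in> stiefel"
      using U orthogonal_matrix_mul[of R U] by (simp add: stiefel_def orthogonal_matrix)
    from max[OF this] have "trace (R ** (U ** M)) \<le> trace (U ** M)"
      by (simp add: trf matrix_mul_assoc)
    moreover have "trace (R ** X) = trace X - 2 * (w \<bullet> (X *v w))" for X
    proof -
      have "trace (R ** X) = (\<Sum>i\<in>UNIV. \<Sum>k\<in>UNIV. (if i = k then X $ k $ i else 0) - 2 * (w $ i * w $ k * X $ k $ i))"
        unfolding trace_def matrix_matrix_mult_def R_def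
        by (auto intro!: sum.cong simp: algebra_simps)
      also have "\<dots> = trace X - 2 * (\<Sum>i\<in>UNIV. \<Sum>k\<in>UNIV. w $ i * w $ k * X $ k $ i)"
        by (simp add: sum_subtractf trace_def sum_distrib_left)
      also have "(\<Sum>i\<in>UNIV. \<Sum>k\<in>UNIV. w $ i * w $ k * X $ k $ i) = w \<bullet> (X *v w)"
        by (subst sum.swap) (simp add: inner_vec_def matrix_vector_mult_def sum_distrib_left mult_ac)
      finally show ?thesis .
    qed
    ultimately have "0 \<le> w \<bullet> (U ** M *v w)" by simp
    then have "0 \<le> (norm v)\<^sup>2 * (w \<bullet> (U ** M *v w))" by simp
    also have "\<dots> = (norm v *\<^sub>R w) \<bullet> (U ** M *v (norm v *\<^sub>R w))"
      by (simp add: matrix_vector_mult_scaleR power2_eq_square)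
    also have "norm v *\<^sub>R w = v" using False by (simp add: w_def)
    finally show ?thesis .
  qed simp
  ultimately have "psd (U ** M)" by (simp add: psd_def)
  \<comment> \<open>The maximizer multiplies \<open>M\<close> without a transpose, so the witness is
    its transpose.\<close>
  then show thesis
    using that[of "transpose U"] U by (simp add: stiefel_transpose_iff)
qed

section \<open>Matrix powers and their traces in an eigenbasis\<close>

lemma matpow_add: "matpow A (i + j) = matpow A i ** matpow A j"
  by (induction i) (simp_all add: matrix_mul_assoc)

lemma matrix_add_rdistrib: "(A + B) ** C = A ** C + B ** C"
  by (vector matrix_matrix_mult_def sum.distrib[symmetric] field_simps)

lemma matpow_Suc_right: "matpow A (Suc m) = matpow A m ** A"
  using matpow_add[of A m 1] by simp

lemma transpose_matpow: "transpose (matpow A m) = matpow (transpose A) m"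
  by (induction m) (simp_all add: matrix_transpose_mul flip: matpow_Suc_right)

lemma diag_mult_nth: "(diag d ** X) $ i $ j = d $ i * X $ i $ j"
  by (simp add: diag_def matrix_matrix_mult_def if_distrib if_distribR cong: if_cong)

lemma diag_mult_diag: "diag d ** diag e = diag (\<chi> i. d $ i * e $ i)"
  by (simp add: vec_eq_iff diag_mult_nth) (simp add: diag_def)

lemma stiefelD: "P \<in> stiefel \<Longrightarrow> transpose P ** P = mat 1"
  by (simp add: stiefel_def)

lemma stiefelD_square: "U \<in> stiefel \<Longrightarrow> U ** transpose U = mat 1"
  for U :: "real^'k^'k"
  by (simp add: stiefel_def matrix_left_right_inverse)

lemma matpow_spectral:
  fixes U :: "real^'k^'k"
  assumes U: "U \<in> stiefel"
  shows "matpow (transpose U ** diag d ** U) m = transpose U ** diag (\<chi> i. d $ i ^ m) ** U"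
proof (induction m)
  case 0
  have "diag (\<chi> i. 1) = (mat 1 :: real^'k^'k)"
    by (simp add: diag_def mat_def vec_eq_iff)
  then show ?case using stiefelD[OF U] by simp
next
  case (Suc m)
  have "matpow (transpose U ** diag d ** U) (Suc m) =
      transpose U ** diag d ** (U ** transpose U) ** diag (\<chi> i. d $ i ^ m) ** U"
    by (simp add: Suc matrix_mul_assoc)
  also have "\<dots> = transpose U ** (diag d ** diag (\<chi> i. d $ i ^ m)) ** U"
    by (simp add: stiefelD_square[OF U] matrix_mul_assoc)
  finally show ?case by (simp add: diag_mult_diag)
qed

lemma trace_spectral:
  fixes U :: "real^'k^'k"
  assumes U: "U \<in> stiefel"
  shows "trace (transpose U ** diag d ** U) = (\<Sum>i\<in>UNIV. d $ i)"
proof -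
  have "trace (transpose U ** diag d ** U) = trace (diag d ** (U ** transpose U))"
    by (metis matrix_mul_assoc trace_mul_sym)
  then show ?thesis
    by (simp add: stiefelD_square[OF U] trace_def diag_def)
qed

lemma psd_spectral:
  fixes A :: "real^'k^'k"
  assumes A: "psd A"
  obtains U :: "real^'k^'k" and d
  where "U \<in> stiefel" "A = transpose U ** diag d ** U" "\<And>i. 0 \<le> d $ i"
proof -
  obtain U :: "real^'k^'k" and d where U: "U \<in> stiefel" and eq: "A = transpose U ** diag d ** U"
    using spectral_symmetric A unfolding psd_def by blast
  have "0 \<le> d $ i" for i
  proof -
    have "U ** A ** transpose U = (U ** transpose U) ** diag d ** (U ** transpose U)"
      by (simp add: eq matrix_mul_assoc)
    then have D: "U ** A ** transpose U = diag d"
      by (simp add: stiefelD_square[OF U])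
    \<comment> \<open>Row \<open>i\<close> of \<open>U\<close>, an eigenvector at which the
      quadratic form takes the value \<open>d $ i\<close>.\<close>
    let ?v = "axis i 1 v* U"
    have "0 \<le> ?v \<bullet> (A *v ?v)" using A by (simp add: psd_def)
    also have "\<dots> = axis i 1 \<bullet> (U *v (A *v (transpose U *v axis i 1)))"
      by (simp add: dot_lmul_matrix)
    also have "\<dots> = axis i 1 \<bullet> (diag d *v axis i 1)"
      by (simp only: matrix_vector_mul_assoc D matrix_mul_assoc)
    also have "\<dots> = d $ i"
      by (simp add: inner_axis' matrix_vector_mul_component diag_def inner_axis)
    finally show ?thesis .
  qed
  with U eq that show thesis by blast
qed

lemma trace_matpow_nonneg:
  fixes A :: "real^'a^'a"
  assumes "psd A"
  shows "0 \<le> trace (matpow A m)"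
proof -
  obtain U :: "real^'a^'a" and d
    where "U \<in> stiefel" "A = transpose U ** diag d ** U" "\<And>i. 0 \<le> d $ i"
    using psd_spectral[OF assms] by metis
  then show ?thesis
    by (simp add: matpow_spectral trace_spectral sum_nonneg)
qed

section \<open>Overlaps of matrices with orthonormal columns\<close>

lemma stiefel_inner:
  assumes "P \<in> stiefel"
  shows "(P *v x) \<bullet> (P *v y) = x \<bullet> y"
proof -
  have "(P *v x) v* P = (transpose P ** P) *v x"
    by (simp flip: matrix_vector_mul_assoc)
  then show ?thesis
    by (simp add: stiefelD[OF assms] flip: dot_lmul_matrix)
qed

text \<open>Column \<open>j\<close> of the overlap is \<open>q\<close>, the image under
  \<open>transpose P\<close> of the unit vector \<open>p\<close>. Since \<open>P\<close> is an
  isometry, Cauchy-Schwarz bounds the square of \<open>norm q\<close> by \<open>norm q\<close>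
  itself.\<close>

lemma stiefel_overlap_col:
  fixes P :: "real^'a^'n" and R :: "real^'b^'n"
  assumes P: "P \<in> stiefel" and R: "R \<in> stiefel"
  shows "(\<Sum>i\<in>UNIV. ((transpose P ** R) $ i $ j)\<^sup>2) \<le> 1"
proof -
  define p where "p = R *v axis j 1"
  define q where "q = p v* P"
  have "norm p = 1"
    by (simp add: p_def norm_eq_1 stiefel_inner[OF R])
  have "norm (P *v q) = norm q"
    by (simp add: norm_eq stiefel_inner[OF P])
  have "(norm q)\<^sup>2 = p \<bullet> (P *v q)"
    unfolding power2_norm_eq_inner by (simp add: q_def dot_lmul_matrix)
  also have "\<dots> \<le> norm p * norm (P *v q)"
    by (rule norm_cauchy_schwarz)
  finally have "(norm q)\<^sup>2 \<le> norm q"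
    using \<open>norm p = 1\<close> \<open>norm (P *v q) = norm q\<close> by simp
  then have "norm q \<le> 1"
    by (cases "norm q = 0") (auto simp: power2_eq_square)
  then have "(norm q)\<^sup>2 \<le> 1"
    by (simp add: power_le_one)
  moreover have "q $ i = (transpose P ** R) $ i $ j" for i
  proof -
    have "q = (transpose P ** R) *v axis j 1"
      by (simp add: q_def p_def flip: matrix_vector_mul_assoc)
    then show ?thesis
      by (simp add: matrix_vector_mul_component inner_axis)
  qed
  ultimately show ?thesis
    unfolding power2_norm_eq_inner inner_vec_def by (simp add: power2_eq_square)
qed

lemma stiefel_overlap_row:
  fixes P :: "real^'a^'n" and R :: "real^'b^'n"
  assumes P: "P \<in> stiefel" and R: "R \<in> stiefel"
  shows "(\<Sum>j\<in>UNIV. ((transpose P ** R) $ i $ j)\<^sup>2) \<le> 1"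
proof -
  have "(transpose R ** P) $ j $ i = (transpose P ** R) $ i $ j" for j
    by (simp add: matrix_matrix_mult_def transpose_def mult.commute)
  then show ?thesis using stiefel_overlap_col[OF R P, of i] by simp
qed

lemma stiefel_mult:
  fixes P :: "real^'k^'n" and Q :: "real^'j^'k"
  assumes "P \<in> stiefel" "Q \<in> stiefel"
  shows "P ** Q \<in> stiefel"
proof -
  have "transpose (P ** Q) ** (P ** Q) = transpose Q ** (transpose P ** P) ** Q"
    by (simp add: matrix_transpose_mul matrix_mul_assoc)
  then show ?thesis using assms by (simp add: stiefel_def)
qed

section \<open>Young inequalities for powers and for traces\<close>

lemma power_young:
  fixes a b :: real
  assumes "0 \<le> a" "0 \<le> b" "1 \<le> m"
  shows "real m * (b * a ^ (m - 1)) \<le> b ^ m + (real m - 1) * a ^ m"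
  using \<open>1 \<le> m\<close>
proof (induction m rule: dec_induct)
  case base
  then show ?case by simp
next
  case (step m)
  \<comment> \<open>Powers are monotone, so both factors have the same sign. Adding this to
    \<open>a\<close> times the induction hypothesis cancels the mixed term
    \<open>a * b ^ m\<close>.\<close>
  have "0 \<le> (b - a) * (b ^ m - a ^ m)"
    using assms by (cases "a \<le> b") (auto simp: zero_le_mult_iff power_mono)
  moreover have "real m * b * a ^ m \<le> a * (b ^ m + (real m - 1) * a ^ m)"
  proof -
    have "a * a ^ (m - 1) = a ^ m"
      using step.hyps by (simp flip: power_Suc)
    then have "a * (real m * (b * a ^ (m - 1))) = real m * b * a ^ m"
      by (metis mult.left_commute mult.assoc)
    then show ?thesis
      using mult_left_mono[OF step.IH \<open>0 \<le> a\<close>] by (simp only:)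
  qed
  ultimately have "real m * b * a ^ m + b * a ^ m \<le> b * b ^ m + real m * (a * a ^ m)"
    by (simp add: algebra_simps)
  then show ?case
    by (simp add: algebra_simps)
qed

lemma trace_diag_sandwich:
  "trace (diag b ** X ** (diag a ** Y)) = (\<Sum>j\<in>UNIV. \<Sum>i\<in>UNIV. b $ j * a $ i * (X $ j $ i * Y $ i $ j))"
  unfolding trace_def matrix_matrix_mult_def[of "diag b ** X"]
  by (simp add: diag_mult_nth mult_ac)

text \<open>In eigenbases of \<open>A\<close> and \<open>B\<close> the left-hand side is a combination of products
  \<open>b\<^sub>j a\<^sub>i\<^sup>m\<^sup>-\<^sup>1\<close> whose coefficients are dominated by a doubly substochastic matrix, so
  the scalar inequality may be applied to each product separately.\<close>
theorem trace_mixed_le: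
  fixes A B :: "real^'k^'k" and P R :: "real^'k^'n"
  assumes A: "psd A" and B: "psd B" and P: "P \<in> stiefel" and R: "R \<in> stiefel" and m: "1 \<le> m"
  shows "real m * trace (B ** matpow A (m - 1) ** (transpose P ** R)) \<le>
    trace (matpow B m) + (real m - 1) * trace (matpow A m)"
proof -
  obtain U :: "real^'k^'k" and a where U: "U \<in> stiefel" "A = transpose U ** diag a ** U"
    and a: "\<And>i. 0 \<le> a $ i"
    using psd_spectral[OF A] by metis
  obtain V :: "real^'k^'k" and b where V: "V \<in> stiefel" "B = transpose V ** diag b ** V"
    and b: "\<And>i. 0 \<le> b $ i"
    using psd_spectral[OF B] by metis
  \<comment> \<open>\<open>X\<close> compares the eigenbases of \<open>B\<close> and
    \<open>A\<close>; \<open>Y\<close> is the overlap \<open>transpose P ** R\<close> written in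
    these bases.\<close>
  define X where "X = V ** transpose U"
  define Y where "Y = transpose (P ** transpose U) ** (R ** transpose V)"
  have tU: "transpose U \<in> stiefel" and tV: "transpose V \<in> stiefel"
    using U V by (simp_all add: stiefel_transpose_iff)
  have X_row: "(\<Sum>i\<in>UNIV. (X $ j $ i)\<^sup>2) \<le> 1" for j
    using stiefel_overlap_row[OF tV tU] by (simp add: X_def)
  have X_col: "(\<Sum>j\<in>UNIV. (X $ j $ i)\<^sup>2) \<le> 1" for i
    using stiefel_overlap_col[OF tV tU] by (simp add: X_def)
  have Y_col: "(\<Sum>i\<in>UNIV. (Y $ i $ j)\<^sup>2) \<le> 1" for j
    using stiefel_overlap_col[OF stiefel_mult[OF P tU] stiefel_mult[OF R tV]] by (simp add: Y_def)
  have Y_row: "(\<Sum>j\<in>UNIV. (Y $ i $ j)\<^sup>2) \<le> 1" for i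
    using stiefel_overlap_row[OF stiefel_mult[OF P tU] stiefel_mult[OF R tV]] by (simp add: Y_def)
  \<comment> \<open>Averaging the squares gives a majorant of \<open>X $ j $ i * Y $ i $ j\<close>.
    The indices of \<open>Y\<close> are swapped, so rows of \<open>X\<close> pair with columns of
    \<open>Y\<close>.\<close>
  define S where "S j i = ((X $ j $ i)\<^sup>2 + (Y $ i $ j)\<^sup>2) / 2" for j i
  have S_row: "(\<Sum>i\<in>UNIV. S j i) \<le> 1" for j
    using X_row[of j] Y_col[of j] by (simp add: S_def sum.distrib flip: sum_divide_distrib)
  have S_col: "(\<Sum>j\<in>UNIV. S j i) \<le> 1" for i
    using X_col[of i] Y_row[of i] by (simp add: S_def sum.distrib flip: sum_divide_distrib)
  have "trace (B ** matpow A (m - 1) ** (transpose P ** R)) =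
      trace (transpose V ** (diag b ** V ** transpose U ** diag (\<chi> i. a $ i ^ (m - 1)) ** U ** transpose P ** R))"
    by (simp add: U V matpow_spectral matrix_mul_assoc)
  also have "\<dots> = trace (diag b ** X ** (diag (\<chi> i. a $ i ^ (m - 1)) ** Y))"
    by (subst trace_mul_sym) (simp add: X_def Y_def matrix_transpose_mul matrix_mul_assoc)
  finally have "real m * trace (B ** matpow A (m - 1) ** (transpose P ** R)) =
      (\<Sum>j\<in>UNIV. \<Sum>i\<in>UNIV. real m * (b $ j * a $ i ^ (m - 1)) * (X $ j $ i * Y $ i $ j))"
    by (simp add: trace_diag_sandwich sum_distrib_left mult_ac)
  also have "\<dots> \<le> (\<Sum>j\<in>UNIV. \<Sum>i\<in>UNIV. (b $ j ^ m + (real m - 1) * a $ i ^ m) * S j i)"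
  proof (intro sum_mono)
    fix i j
    have "X $ j $ i * Y $ i $ j \<le> S j i"
      using sum_squares_bound[of "X $ j $ i" "Y $ i $ j"] by (simp add: S_def)
    \<comment> \<open>The entry product may be negative, so it is replaced by the nonnegative
      \<open>S j i\<close> before \<open>power_young\<close> is multiplied through.\<close>
    then have "real m * (b $ j * a $ i ^ (m - 1)) * (X $ j $ i * Y $ i $ j)
        \<le> real m * (b $ j * a $ i ^ (m - 1)) * S j i"
      using a b by (intro mult_left_mono) auto
    also have "\<dots> \<le> (b $ j ^ m + (real m - 1) * a $ i ^ m) * S j i"
      using a b m by (intro mult_right_mono power_young) (auto simp: S_def)
    finally show "real m * (b $ j * a $ i ^ (m - 1)) * (X $ j $ i * Y $ i $ j)
        \<le> (b $ j ^ m + (real m - 1) * a $ i ^ m) * S j i" .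
  qed
  also have "\<dots> = (\<Sum>j\<in>UNIV. b $ j ^ m * (\<Sum>i\<in>UNIV. S j i))
      + (real m - 1) * (\<Sum>i\<in>UNIV. a $ i ^ m * (\<Sum>j\<in>UNIV. S j i))"
  proof -
    have "(\<Sum>j\<in>UNIV. \<Sum>i\<in>UNIV. a $ i ^ m * S j i) = (\<Sum>i\<in>UNIV. a $ i ^ m * (\<Sum>j\<in>UNIV. S j i))"
      by (subst sum.swap) (simp add: sum_distrib_left)
    then show ?thesis
      by (simp add: distrib_right sum.distrib sum_distrib_left[symmetric] mult.assoc)
  qed
  \<comment> \<open>The substochastic sums may be replaced by 1 because the weights, including
    \<open>real m - 1\<close>, are nonnegative.\<close>
  also have "\<dots> \<le> (\<Sum>j\<in>UNIV. b $ j ^ m * 1) + (real m - 1) * (\<Sum>i\<in>UNIV. a $ i ^ m * 1)"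
    using a b m by (intro add_mono mult_left_mono sum_mono S_row S_col) auto
  also have "\<dots> = trace (matpow B m) + (real m - 1) * trace (matpow A m)"
    by (simp add: U V matpow_spectral trace_spectral)
  finally show ?thesis .
qed

text \<open>Young's inequality for \<open>u\<close> and \<open>t powr (s - 1)\<close>: the exponent
  \<open>q\<close> conjugate to \<open>s\<close> turns the second factor into
  \<open>t powr s\<close>.\<close>

lemma powr_young:
  fixes s t u :: real
  assumes s: "1 < s" and "0 \<le> t" "0 \<le> u"
  shows "s * (t powr (s - 1) * u) \<le> u powr s + (s - 1) * t powr s"
proof -
  define q where "q = s / (s - 1)"
  have "u * t powr (s - 1) \<le> u powr s / s + (t powr (s - 1)) powr q / q"
    using assms by (intro Youngs_inequality) (auto simp: q_def field_simps)
  also have "(t powr (s - 1)) powr q = t powr s"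
    using s by (simp add: powr_powr q_def)
  finally have "s * (u * t powr (s - 1)) \<le> s * (u powr s / s + t powr s / q)"
    using s by (intro mult_left_mono) auto
  also have "\<dots> = u powr s + (s - 1) * t powr s"
    using s by (simp add: q_def field_simps)
  finally show ?thesis by (simp add: mult.commute)
qed

section \<open>Derivatives of matrix powers and the gradient of \<open>gfun\<close>\<close>

lemma bounded_bilinear_matrix_mult:
  "bounded_bilinear ((**) :: real^'b^'a \<Rightarrow> real^'c^'b \<Rightarrow> real^'c^'a)"
  unfolding bilinear_conv_bounded_bilinear[symmetric] bilinear_def
  by (intro conjI allI linearI)
    (simp_all add: matrix_add_ldistrib matrix_add_rdistrib matrix_scalar_ac flip: scalar_matrix_assoc)

lemma bounded_linear_transpose: "bounded_linear (transpose :: real^'b^'a \<Rightarrow> real^'a^'b)"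
  unfolding linear_conv_bounded_linear[symmetric]
  by (rule linearI) (simp_all add: transpose_def vec_eq_iff)

lemma trace_scaleR: "trace (c *\<^sub>R A) = c * trace A" for A :: "real^'a^'a"
  by (simp add: trace_def sum_distrib_left)

lemma bounded_linear_trace: "bounded_linear (trace :: real^'a^'a \<Rightarrow> real)"
  unfolding linear_conv_bounded_linear[symmetric]
  by (rule linearI) (simp_all add: trace_add trace_scaleR)

text \<open>\<open>f x\<close> and \<open>f' h\<close> need not commute, so \<open>L\<close> itself
  does not collapse, but under a trace against a power of \<open>f x\<close> cyclicity makes all
  product-rule terms equal. The free exponent \<open>j\<close> lets the induction absorb the factor
  split off by the product rule; \<open>j = 0\<close> is the case used later.\<close>

lemma has_derivative_matpow:
  fixes f :: "'b::real_normed_vector \<Rightarrow> real^'a^'a"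
  assumes f: "(f has_derivative f') (at x)"
  obtains L where "((\<lambda>y. matpow (f y) m) has_derivative L) (at x)"
    "\<And>j h. trace (matpow (f x) j ** L h) = real m * trace (matpow (f x) (j + (m - 1)) ** f' h)"
proof (induction m arbitrary: thesis)
  case 0
  show ?case by (rule 0[of "\<lambda>_. 0"]) (simp_all add: trace_def)
next
  case (Suc m)
  obtain L where L: "((\<lambda>y. matpow (f y) m) has_derivative L) (at x)"
    and tr: "\<And>j h. trace (matpow (f x) j ** L h) = real m * trace (matpow (f x) (j + (m - 1)) ** f' h)"
    using Suc.IH by blast
  let ?A = "f x"
  show ?case
  proof (rule Suc.prems)
    show "((\<lambda>y. matpow (f y) (Suc m)) has_derivative (\<lambda>h. ?A ** L h + f' h ** matpow ?A m)) (at x)"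
      using bounded_bilinear.FDERIV[OF bounded_bilinear_matrix_mult f L] by simp
    fix j h
    have "trace (matpow ?A j ** (?A ** L h)) = real m * trace (matpow ?A (Suc j + (m - 1)) ** f' h)"
      using tr[of "Suc j" h] unfolding matpow_Suc_right by (simp add: matrix_mul_assoc)
    \<comment> \<open>For \<open>m = 0\<close> truncated subtraction changes the exponent, but the
      factor \<open>real m\<close> makes both sides 0.\<close>
    also have "\<dots> = real m * trace (matpow ?A (j + m) ** f' h)"
      by (cases m) simp_all
    finally have 1: "trace (matpow ?A j ** (?A ** L h)) = real m * trace (matpow ?A (j + m) ** f' h)" .
    have 2: "trace (matpow ?A j ** (f' h ** matpow ?A m)) = trace (matpow ?A (j + m) ** f' h)"
      by (metis add.commute matpow_add matrix_mul_assoc trace_mul_sym)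
    show "trace (matpow ?A j ** (?A ** L h + f' h ** matpow ?A m)) =
        real (Suc m) * trace (matpow ?A (j + (Suc m - 1)) ** f' h)"
      by (simp add: matrix_add_ldistrib trace_add 1 2 distrib_right)
  qed
qed

lemma trace_transpose_mult: "trace (transpose A ** B) = A \<bullet> B"
  for A B :: "real^'k^'n"
  unfolding trace_def matrix_matrix_mult_def transpose_def inner_vec_def
  by (simp add: inner_vec_def) (rule sum.swap)

lemma trpow_has_derivative:
  "(trpow D m has_derivative (\<lambda>h. h \<bullet> (real m *\<^sub>R (D ** matpow (transpose P ** D) (m - 1))))) (at P)"
proof -
  let ?A = "transpose P ** D"
  have "((\<lambda>P. transpose P ** D) has_derivative (\<lambda>h. transpose h ** D)) (at P)"
    using bounded_linear.has_derivative[OF bounded_bilinear.bounded_linear_left[OF bounded_bilinear_matrix_mult]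
        bounded_linear_imp_has_derivative[OF bounded_linear_transpose]] .
  then obtain L where L: "((\<lambda>P. matpow (transpose P ** D) m) has_derivative L) (at P)"
    and tr: "\<And>j h. trace (matpow ?A j ** L h) = real m * trace (matpow ?A (j + (m - 1)) ** (transpose h ** D))"
    using has_derivative_matpow[where m = m] by blast
  have "trace (L h) = h \<bullet> (real m *\<^sub>R (D ** matpow ?A (m - 1)))" for h
  proof -
    have "trace (L h) = real m * trace (matpow ?A (m - 1) ** (transpose h ** D))"
      using tr[of 0 h] by simp
    also have "trace (matpow ?A (m - 1) ** (transpose h ** D)) = trace (transpose h ** (D ** matpow ?A (m - 1)))"
      by (subst trace_mul_sym) (simp add: matrix_mul_assoc)
    finally show ?thesis by (simp add: trace_transpose_mult)
  qed
  then show ?thesis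
    using bounded_linear.has_derivative[OF bounded_linear_trace L] unfolding trpow_def by simp
qed

text \<open>The chain rule along each matrix unit reads off one entry of \<open>G\<close>, so the
  matrix representing the total derivative is the matrix of partial derivatives.\<close>

lemma matrix_gradient_eqI:
  assumes f: "(f has_derivative (\<lambda>h. h \<bullet> G)) (at P)"
  shows "matrix_gradient f P = G"
proof -
  have "deriv (\<lambda>t. f (P + t *\<^sub>R axis i (axis j 1))) 0 = G $ i $ j" for i j
  proof (rule DERIV_imp_deriv)
    let ?E = "axis i (axis j (1::real))"
    have "((\<lambda>t. P + t *\<^sub>R ?E) has_derivative (\<lambda>t. t *\<^sub>R ?E)) (at 0)"
      by (auto intro!: derivative_eq_intros)
    from has_derivative_compose[OF this, of f "\<lambda>h. h \<bullet> G"] f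
    have "((\<lambda>t. f (P + t *\<^sub>R ?E)) has_derivative (\<lambda>t. (t *\<^sub>R ?E) \<bullet> G)) (at 0)"
      by simp
    then show "((\<lambda>t. f (P + t *\<^sub>R ?E)) has_real_derivative G $ i $ j) (at 0)"
      unfolding has_field_derivative_def
      by (simp add: inner_axis' mult.commute[of _ "G $ i $ j"])
  qed
  then show ?thesis
    by (simp add: matrix_gradient_def vec_eq_iff)
qed

lemma matrix_gradient_trpow:
  "matrix_gradient (trpow D m) P = real m *\<^sub>R (D ** matpow (transpose P ** D) (m - 1))"
  by (rule matrix_gradient_eqI[OF trpow_has_derivative])

lemma gfun_has_derivative:
  assumes "0 < trpow D m P"
  shows "(gfun D m s has_derivative
    (\<lambda>h. h \<bullet> ((s * trpow D m P powr (s - 1)) *\<^sub>R matrix_gradient (trpow D m) P))) (at P)"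
proof -
  have "((\<lambda>x. x powr s) has_derivative (\<lambda>h. (s * trpow D m P powr (s - 1)) * h)) (at (trpow D m P))"
    using has_real_derivative_powr[OF assms, of s] by (simp add: has_field_derivative_def)
  from has_derivative_compose[OF trpow_has_derivative this]
  show ?thesis
    by (simp add: gfun_def[abs_def] matrix_gradient_trpow mult.assoc)
qed

text \<open>At vanishing trace the convention agrees with the formula, since
  \<open>0 powr (s - 1)\<close> is 0; elsewhere in \<open>gdom\<close> the trace is positive and the
  chain rule applies.\<close>

lemma grad_g_eq:
  "grad_g D m s P = (s * trpow D m P powr (s - 1)) *\<^sub>R matrix_gradient (trpow D m) P"
  if "P \<in> gdom D m"
  using that matrix_gradient_eqI[OF gfun_has_derivative, of D m P s]
  by (cases "trpow D m P = 0") (auto simp: grad_g_def gdom_def)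

section \<open>Identities and the trace bound for \<open>Hmat\<close> and \<open>Hg\<close>\<close>

lemma stiefel_plusD:
  assumes "P \<in> stiefel_plus D"
  shows "P \<in> stiefel" "psd (transpose P ** D)" "0 \<le> trpow D m P"
  using assms by (auto simp: stiefel_plus_def trpow_def intro: trace_matpow_nonneg)

lemma transpose_Hmat: "transpose (Hmat D m P) = Hmat D m P"
proof -
  have add: "transpose (A + B) = transpose A + transpose B" for A B :: "real^'n^'n"
    by (simp add: transpose_def vec_eq_iff)
  show ?thesis
    by (simp add: Hmat_def transpose_scalar add matrix_transpose_mul transpose_matpow matrix_mul_assoc add.commute)
qed

lemma transpose_Hg: "transpose (Hg D m s P) = Hg D m s P"
  by (simp add: Hg_def transpose_scalar transpose_Hmat)

text \<open>Orthonormality of the columns of \<open>P\<close> collapses the first summand of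
  \<open>Hmat\<close> to the gradient; in the second, the trailing \<open>transpose D ** P\<close>
  raises the power from \<open>m - 1\<close> to \<open>m\<close>.\<close>

lemma Hmat_mult:
  assumes P: "P \<in> stiefel" and m: "1 \<le> m"
  shows "Hmat D m P ** P = matrix_gradient (trpow D m) P + real m *\<^sub>R (P ** matpow (transpose D ** P) m)"
proof -
  have "Hmat D m P ** P = real m *\<^sub>R (D ** matpow (transpose P ** D) (m - 1) ** (transpose P ** P) +
      P ** (matpow (transpose D ** P) (m - 1) ** (transpose D ** P)))"
    by (simp add: Hmat_def matrix_add_rdistrib matrix_mul_assoc flip: scalar_matrix_assoc)
  also have "matpow (transpose D ** P) (m - 1) ** (transpose D ** P) = matpow (transpose D ** P) m"
    using m matpow_Suc_right[of "transpose D ** P" "m - 1"] by simp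
  finally show ?thesis
    by (simp add: stiefelD[OF P] matrix_gradient_trpow scaleR_add_right)
qed

lemma trace_transpose [simp]: "trace (transpose A) = trace A"
  by (simp add: trace_def transpose_def)

text \<open>The two summands of \<open>Hmat\<close> are transposes of each other and contribute
  equal traces, hence the factor 2.\<close>

lemma trace_Hmat:
  "trace (transpose R ** Hmat D m P ** R) =
    2 * (real m * trace (transpose R ** D ** matpow (transpose P ** D) (m - 1) ** (transpose P ** R)))"
proof -
  let ?X = "transpose R ** D ** matpow (transpose P ** D) (m - 1) ** (transpose P ** R)"
  have "transpose R ** Hmat D m P ** R = real m *\<^sub>R (?X + transpose ?X)"
    by (simp add: Hmat_def matrix_add_rdistrib matrix_add_ldistrib matrix_mul_assoc matrix_scalar_ac
        matrix_transpose_mul transpose_matpow scaleR_add_right flip: scalar_matrix_assoc)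
  then show ?thesis by (simp add: trace_scaleR trace_add)
qed

lemma trace_Hg:
  "trace (transpose R ** Hg D m s P ** R) = s * trpow D m P powr (s - 1) * trace (transpose R ** Hmat D m P ** R)"
  by (simp add: Hg_def matrix_scalar_ac trace_scaleR flip: scalar_matrix_assoc)

lemma trace_Hg_self:
  assumes P: "P \<in> stiefel_plus D" and m: "1 \<le> m"
  shows "trace (transpose P ** Hg D m s P ** P) = 2 * s * real m * trpow D m P powr s"
proof -
  note P' = stiefel_plusD[OF P]
  have "trace (transpose P ** Hmat D m P ** P) = 2 * (real m * trpow D m P)"
    using m by (cases m) (simp_all add: trace_Hmat stiefelD[OF P'(1)] trpow_def)
  \<comment> \<open>Exponents add because the trace is nonnegative; at zero both sides are
    0.\<close>
  moreover have "trpow D m P powr (s - 1) * trpow D m P = trpow D m P powr s"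
    using P'(3)[of m] by (cases "trpow D m P = 0") (simp_all add: powr_mult_base mult.commute)
  ultimately show ?thesis
    by (simp add: trace_Hg mult_ac)
qed

text \<open>The constant collects two contributions: \<open>trace_mixed_le\<close> leaves
  \<open>2 * s * (real m - 1)\<close> and \<open>powr_young\<close> adds \<open>2 * (s - 1)\<close>,
  together \<open>2 * (s * real m - 1)\<close>.\<close>

lemma trace_Hg_le:
  assumes P: "P \<in> stiefel_plus D" and R: "R \<in> stiefel_plus D" and m: "1 \<le> m" and s: "1 < s"
  shows "trace (transpose R ** Hg D m s P ** R) \<le>
    2 * trpow D m R powr s + 2 * (s * real m - 1) * trpow D m P powr s"
proof -
  note P' = stiefel_plusD[OF P] and R' = stiefel_plusD[OF R]
  let ?t = "trpow D m P" and ?u = "trpow D m R"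
  have "real m * trace (transpose R ** D ** matpow (transpose P ** D) (m - 1) ** (transpose P ** R))
      \<le> ?u + (real m - 1) * ?t"
    unfolding trpow_def by (rule trace_mixed_le[OF P'(2) R'(2) P'(1) R'(1) m])
  then have "s * ?t powr (s - 1) * trace (transpose R ** Hmat D m P ** R) \<le>
      s * ?t powr (s - 1) * (2 * (?u + (real m - 1) * ?t))"
    using s by (intro mult_left_mono) (simp_all add: trace_Hmat)
  also have "\<dots> = 2 * (s * (?t powr (s - 1) * ?u)) + 2 * s * (real m - 1) * (?t powr (s - 1) * ?t)"
    by (simp add: algebra_simps)
  also have "?t powr (s - 1) * ?t = ?t powr s"
    using P'(3)[of m] by (cases "?t = 0") (simp_all add: powr_mult_base mult.commute)
  also have "2 * (s * (?t powr (s - 1) * ?u)) \<le> 2 * (?u powr s + (s - 1) * ?t powr s)"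
    using powr_young[OF s P'(3)[of m] R'(3)[of m]] by simp
  finally show ?thesis
    by (simp add: trace_Hg algebra_simps)
qed

section \<open>The rotation in condition (2) and the atomic function property\<close>

lemma ex_stiefel_plus_rotation:
  assumes R: "R \<in> stiefel"
  obtains Q :: "real^'k^'k" where "Q \<in> stiefel" "R ** Q \<in> stiefel_plus (D :: real^'k^'n)"
proof -
  \<comment> \<open>The orthogonal polar factor of \<open>transpose R ** D\<close> makes
    \<open>transpose (R ** Q) ** D\<close> positive semidefinite.\<close>
  obtain Q :: "real^'k^'k" where Q: "Q \<in> stiefel" "psd (transpose Q ** (transpose R ** D))"
    using polar_decomposition .
  then show thesis
    using that[OF Q(1)] stiefel_mult[OF R Q(1)]
    by (simp add: stiefel_plus_def matrix_transpose_mul matrix_mul_assoc)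
qed

text \<open>By cyclicity \<open>Q\<close> meets its transpose and cancels. Thus a bound proved at
  \<open>R ** Q\<close>, which lies in \<open>stiefel_plus D\<close>, carries over to the arbitrary
  point \<open>R\<close> of condition (2).\<close>

lemma trace_conj_rotation:
  fixes R :: "real^'k^'n" and Q :: "real^'k^'k"
  assumes "Q \<in> stiefel"
  shows "trace (transpose (R ** Q) ** H ** (R ** Q)) = trace (transpose R ** H ** R)"
proof -
  have "trace (transpose (R ** Q) ** H ** (R ** Q)) = trace (transpose Q ** (transpose R ** H ** R ** Q))"
    by (simp add: matrix_transpose_mul matrix_mul_assoc)
  also have "\<dots> = trace (transpose R ** H ** R ** (Q ** transpose Q))"
    by (subst trace_mul_sym) (simp add: matrix_mul_assoc)
  finally show ?thesis by (simp add: stiefelD_square[OF assms])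
qed

lemma atomic_gfun:
  fixes D :: "real^'k^'n"
  assumes m: "1 \<le> m" and s: "1 < s"
  shows "atomic_NEPv_with (gdom D m) (gfun D m s) (Hg D m s) (stiefel_plus D) 2 (2 * (s * real m - 1))"
  unfolding atomic_NEPv_with_def
proof (intro conjI ballI)
  have "1 * 1 \<le> s * real m" using m s by (intro mult_mono) auto
  then show "0 \<le> 2 * (s * real m - 1)" by simp
  show "stiefel_plus D \<subseteq> stiefel \<inter> gdom D m"
    by (auto simp: gdom_def dest: stiefel_plusD)
next
  fix P assume P: "P \<in> stiefel_plus D"
  show "trace (transpose P ** Hg D m s P ** P) = (2 + 2 * (s * real m - 1)) * gfun D m s P"
    by (simp add: trace_Hg_self[OF P m] gfun_def)
  fix R :: "real^'k^'n" assume "R \<in> stiefel"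
  then obtain Q :: "real^'k^'k" where Q: "Q \<in> stiefel" "R ** Q \<in> stiefel_plus D"
    by (rule ex_stiefel_plus_rotation)
  show "\<exists>Q::real^'k^'k. Q \<in> stiefel \<and> R ** Q \<in> stiefel_plus D \<and>
      trace (transpose R ** Hg D m s P ** R) \<le> 2 * gfun D m s (R ** Q) + 2 * (s * real m - 1) * gfun D m s P"
    using Q trace_Hg_le[OF P Q(2) m s] by (auto simp: trace_conj_rotation gfun_def)
qed (simp_all add: transpose_Hg)

theorem corollary7p1:
  fixes D :: "real^'k^'n" and m :: nat and s :: real
  assumes "CARD('k) \<le> CARD('n)" and "m \<ge> 1" and "s > 1"
  shows
    "(\<forall>P\<in>gdom D m. 0 < trpow D m P \<longrightarrow> gfun D m s differentiable (at P)) \<and>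
     (\<forall>P\<in>gdom D m. grad_g D m s P =
        (s * trpow D m P powr (s - 1)) *\<^sub>R matrix_gradient (trpow D m) P) \<and>
     (\<forall>P\<in>stiefel \<inter> gdom D m. Hg D m s P ** P - grad_g D m s P =
        P ** ((s * real m * trpow D m P powr (s - 1)) *\<^sub>R matpow (transpose D ** P) m)) \<and>
     (\<forall>P\<in>stiefel_plus D.
        trace (transpose P ** Hg D m s P ** P) = 2 * s * real m * trpow D m P powr s) \<and>
     (\<forall>P\<in>stiefel_plus D. \<forall>Pt\<in>stiefel_plus D.
        trace (transpose Pt ** Hg D m s P ** Pt) \<le>
          2 * trpow D m Pt powr s + 2 * (s * real m - 1) * trpow D m P powr s) \<and>
     atomic_NEPv_with (gdom D m) (gfun D m s) (Hg D m s) (stiefel_plus D) 2 (2 * (s * real m - 1)) \<and>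
     atomic_NEPv (gdom D m) (gfun D m s)"
proof (intro conjI ballI impI)
  fix P :: "real^'k^'n" assume "0 < trpow D m P"
  then show "gfun D m s differentiable (at P)"
    unfolding differentiable_def by (blast intro: gfun_has_derivative)
next
  fix P :: "real^'k^'n" assume "P \<in> stiefel \<inter> gdom D m"
  \<comment> \<open>Scaling \<open>Hmat_mult\<close> by \<open>s * trpow D m P powr (s - 1)\<close>
    turns its gradient part into \<open>grad_g\<close>, which cancels.\<close>
  then show "Hg D m s P ** P - grad_g D m s P =
      P ** ((s * real m * trpow D m P powr (s - 1)) *\<^sub>R matpow (transpose D ** P) m)"
    using \<open>m \<ge> 1\<close>
    by (simp add: grad_g_eq Hg_def Hmat_mult matrix_scalar_ac scaleR_add_right mult_ac
        flip: scalar_matrix_assoc)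
next
  show "atomic_NEPv (gdom D m) (gfun D m s)"
    unfolding atomic_NEPv_def using atomic_gfun[OF assms(2,3)] by blast
qed (assumption | rule grad_g_eq trace_Hg_self trace_Hg_le atomic_gfun assms)+

end
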